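(* Let $\mathcal{G}=(g_1,g_2,\dots)$ be the list defined below. Then every nonzero ZF-word (words identified up to leading zeros) occurs exactly once in $\mathcal{G}$, so that $g_n\mapsto n$ is a bijection from the set of nonzero ZF-words onto $\mathbb{N}^*$. Moreover, for every $n\geq 1$, \[h(g_n,g_{n+1})=\begin{cases}2&\text{if } n+1=F_k \text{ for some } k\geq 3,\\ 1&\text{otherwise.}\end{cases}\]
   Context: Fibonacci numbers: $F_1=F_2=1$, $F_{m+2}=F_{m+1}+F_m$. A ZF-word is a binary word with no two consecutive $1$s; words differing only by leading zeros are identified, and a word is nonzero if it contains a $1$. For a list $\mathcal{L}$ of words: $w\mathcal{L}$ prefixes the word $w$ to each element; $\mathcal{L}'$ removes the leftmost letter of each element; $\overline{\mathcal{L}}$ is the list in reverse order; $\mathcal{L}_1+\mathcal{L}_2$ is concatenation of lists. Define $\mathcal{N}_0=\varnothing$ (empty list), $\mathcal{N}_1=(1)$, and for $n\geq 2$, $\mathcal{N}_n=10\overline{\mathcal{N}_{n-1}'}+10\overline{\mathcal{N}_{n-2}}$ (so e.g. $\mathcal{N}_2=(10)$, $\mathcal{N}_3=(100,101)$, $\mathcal{N}_4=(1001,1000,1010)$). Let $\mathcal{G}=\mathcal{N}_1+\mathcal{N}_2+\mathcal{N}_3+\cdots=(g_1,g_2,\dots)$. The Hamming distance $h(w,w')$ is the number of positions where $w,w'$ differ, after padding the shorter word with leading zeros to equal length. *)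

theory Defs
  imports "HOL-Library.Stream" "HOL-Number_Theory.Fib"
begin

text \<open>
  Binary words are Boolean lists, leftmost letter first, with \<^const>\<open>True\<close> for the letter 1 and
  \<^const>\<open>False\<close> for the letter 0.
\<close>

type_synonym binword = "bool list"

definition zf_word :: "binword \<Rightarrow> bool" where
  "zf_word w \<longleftrightarrow> (\<forall>i. Suc i < length w \<longrightarrow> \<not> (w ! i \<and> w ! Suc i))"

definition nonzero_word :: "binword \<Rightarrow> bool" where
  "nonzero_word w \<longleftrightarrow> True \<in> set w"

definition same_word :: "binword \<Rightarrow> binword \<Rightarrow> bool" where
  "same_word u v \<longleftrightarrow>
     (\<exists>k. u = replicate k False @ v \<or> v = replicate k False @ u)"

definition word_class :: "binword \<Rightarrow> binword set" where
  "word_class w = {(u, v). same_word u v} `` {w}"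

definition nonzero_zf_classes :: "binword set set" where
  "nonzero_zf_classes = {w. zf_word w \<and> nonzero_word w} // {(u, v). same_word u v}"

lemma same_word_iff: "same_word u v \<longleftrightarrow> dropWhile Not u = dropWhile Not v"
proof
  have drop: "dropWhile Not (replicate k False @ w) = dropWhile Not w" for k w
    by (induction k) auto
  show "same_word u v \<Longrightarrow> dropWhile Not u = dropWhile Not v"
    unfolding same_word_def using drop by metis
next
  assume eq: "dropWhile Not u = dropWhile Not v"
  have split: "\<exists>k. w = replicate k False @ dropWhile Not w" for w
  proof (induction w)
    case (Cons a w)
    then obtain k where "w = replicate k False @ dropWhile Not w" by blast
    then show ?case
      by (cases a) (auto intro: exI[of _ "Suc k"] exI[of _ 0])
  qed simp
  obtain k l where k: "u = replicate k False @ dropWhile Not u"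
    and l: "v = replicate l False @ dropWhile Not u"
    using split[of u] split[of v] eq by metis
  show "same_word u v"
  proof (cases "k \<le> l")
    case True
    have "v = replicate (l - k + k) False @ dropWhile Not u"
      using l True by simp
    also have "\<dots> = replicate (l - k) False @ u"
      using k by (metis append_assoc replicate_add)
    finally show ?thesis unfolding same_word_def by blast
  next
    case False
    have "u = replicate (k - l + l) False @ dropWhile Not u"
      using k False by simp
    also have "\<dots> = replicate (k - l) False @ v"
      using l by (metis append_assoc replicate_add)
    finally show ?thesis unfolding same_word_def by blast
  qed
qed

lemma equiv_same_word: "equiv UNIV {(u, v). same_word u v}"
  by (auto simp: same_word_iff intro!: equivI reflI symI transI)

definition pad_to :: "nat \<Rightarrow> binword \<Rightarrow> binword" where
  "pad_to m w = replicate (m - length w) False @ w"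

definition hamming :: "binword \<Rightarrow> binword \<Rightarrow> nat" where
  "hamming u v =
     (let m = max (length u) (length v)
      in card {i. i < m \<and> pad_to m u ! i \<noteq> pad_to m v ! i})"

definition prefix_all :: "binword \<Rightarrow> binword list \<Rightarrow> binword list" where
  "prefix_all w L = map ((@) w) L"

fun N_list :: "nat \<Rightarrow> binword list" where
  "N_list 0 = []"
| "N_list (Suc 0) = [[True]]"
| "N_list (Suc (Suc n)) =
     prefix_all [True, False] (rev (map tl (N_list (Suc n)))) @
     prefix_all [True, False] (rev (N_list n))"

text \<open>
  \<^const>\<open>flat\<close> is the concatenation of a stream of lists provided that none of them is empty; this
  holds here because the empty list \<open>N_list 0\<close> is left out.
\<close>

lemma N_list_nonempty: "n \<ge> 1 \<Longrightarrow> N_list n \<noteq> []"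
  by (induction n rule: N_list.induct) (auto simp: prefix_all_def)

definition G_list :: "binword stream" where
  "G_list = flat (smap N_list (fromN 1))"

text \<open>Streams are indexed from 0, whereas \<open>g\<^sub>1\<close> is the first element of the list.\<close>

definition g_word :: "nat \<Rightarrow> binword" where
  "g_word n = G_list !! (n - 1)"

end

theory Submission
  imports Defs
begin

text \<open>
  The list \<open>N_list n\<close> enumerates the ZF-words of length \<open>n\<close> with leading letter 1, so its length is
  \<open>fib n\<close>, and its first word is \<open>10t\<close>, where \<open>1t\<close> is the last word of \<open>N_list (n - 1)\<close>. Hence the
  step between consecutive lists exchanges the leading \<open>01\<close> for \<open>10\<close>, and at the junction
  of the two parts of a single list the words \<open>100t\<close> and \<open>101t\<close> are adjacent. As
  \<open>fib 1 + \<dots> + fib m = fib (m + 2) - 1\<close>, the list \<open>N_list m\<close> fills the positions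
  \<open>fib (m + 1), \<dots>, fib (m + 2) - 1\<close>.
\<close>

section \<open>ZF-words and the contents of the lists \<open>N_list n\<close>\<close>

lemma zf_word_Nil [simp]: "zf_word []"
  by (simp add: zf_word_def)

lemma zf_word_Cons: "zf_word (a # w) \<longleftrightarrow> \<not> (a \<and> w \<noteq> [] \<and> hd w) \<and> zf_word w"
proof (cases w)
  case (Cons b v)
  have "zf_word (a # w) \<longleftrightarrow>
      (\<forall>i. i < Suc (length v) \<longrightarrow> \<not> ((a # b # v) ! i \<and> (b # v) ! i))"
    by (simp add: zf_word_def Cons)
  also have "\<dots> \<longleftrightarrow> \<not> (a \<and> b) \<and> (\<forall>i<length v. \<not> ((b # v) ! i \<and> v ! i))"
    by (auto simp: less_Suc_eq_0_disj)
  finally show ?thesis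
    by (simp add: zf_word_def Cons)
qed (simp add: zf_word_def)

lemma zf_word_dropWhile: "zf_word w \<Longrightarrow> zf_word (dropWhile P w)"
  by (induction w) (auto simp: zf_word_Cons)

text \<open>A ZF-word of length \<open>n + 2\<close> with leading 1 has the form \<open>10t\<close>.
  If \<open>t\<close> begins with 1, it lies in \<open>N_list n\<close>; otherwise \<open>1t\<close>
  is still a ZF-word and lies in \<open>N_list (Suc n)\<close>. The two cases match the two parts of
  the recursion.\<close>

lemma set_N_list: "set (N_list n) = {w. length w = n \<and> w \<noteq> [] \<and> hd w \<and> zf_word w}"
proof (induction n rule: N_list.induct)
  case 2
  show ?case
    by (auto simp: zf_word_Cons length_Suc_conv)
next
  case (3 n)
  show ?case
  proof (intro set_eqI iffI)
    fix w
    assume "w \<in> set (N_list (Suc (Suc n)))"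
    then consider u where "u \<in> set (N_list (Suc n))" "w = True # False # tl u"
      | u where "u \<in> set (N_list n)" "w = True # False # u"
      by (auto simp: prefix_all_def)
    then show "w \<in> {w. length w = Suc (Suc n) \<and> w \<noteq> [] \<and> hd w \<and> zf_word w}"
    proof cases
      case 1
      then have "length u = Suc n \<and> u \<noteq> [] \<and> hd u \<and> zf_word u"
        using "3.IH"(1) by blast
      then show ?thesis
        using 1 by (cases u) (auto simp: zf_word_Cons)
    next
      case 2
      then have "length u = n \<and> zf_word u"
        using "3.IH"(2) by blast
      then show ?thesis
        using 2 by (simp add: zf_word_Cons)
    qed
  next
    fix w
    assume "w \<in> {w. length w = Suc (Suc n) \<and> w \<noteq> [] \<and> hd w \<and> zf_word w}"
    then obtain t where w: "w = True # False # t" and t: "length t = n" "zf_word t"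
      by (auto simp: length_Suc_conv zf_word_Cons)
    show "w \<in> set (N_list (Suc (Suc n)))"
    proof (cases "t \<noteq> [] \<and> hd t")
      case True
      then show ?thesis
        using t w 3 by (simp add: prefix_all_def)
    next
      case False
      then have "True # t \<in> set (N_list (Suc n))"
        using t 3 by (simp add: zf_word_Cons)
      then have "t \<in> tl ` set (N_list (Suc n))"
        by force
      then show ?thesis
        using w by (simp add: prefix_all_def)
    qed
  qed
qed simp

lemma N_list_eq_Cons: "w \<in> set (N_list n) \<Longrightarrow> w = True # tl w"
  by (cases w) (auto simp: set_N_list)

lemma length_N_list [simp]: "length (N_list n) = fib n"
  by (induction n rule: N_list.induct) (auto simp: prefix_all_def)

text \<open>The two parts are disjoint: after the prefix \<open>10\<close>, words of the second part
  go on with 1, while those of the first go on with \<open>tl u\<close> where \<open>1\<close>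
  followed by \<open>tl u\<close> is a ZF-word, so not with 1.\<close>

lemma distinct_N_list: "distinct (N_list n)"
proof (induction n rule: N_list.induct)
  case (3 n)
  have inj: "inj_on tl (set (N_list (Suc n)))"
    using N_list_eq_Cons by (metis inj_onI)
  have "tl u \<noteq> v" if u: "u \<in> set (N_list (Suc n))" and v: "v \<in> set (N_list n)" for u v
  proof -
    have "zf_word (True # tl u)"
      using u N_list_eq_Cons[OF u] by (simp add: set_N_list del: N_list.simps)
    then show ?thesis
      using v by (auto simp: set_N_list zf_word_Cons)
  qed
  then show ?case
    using 3 inj by (auto simp: prefix_all_def distinct_map inj_on_def)
qed auto

lemma hd_N_list:
  assumes "n \<ge> 1"
  shows "hd (N_list (Suc n)) = True # False # tl (last (N_list n))"
  using assms N_list_nonempty[of n]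
  by (cases n) (auto simp: prefix_all_def hd_append hd_map hd_rev last_map)

section \<open>Hamming distances within one list and under a shift\<close>

lemma hamming_eq_length:
  "length u = length v \<Longrightarrow> hamming u v = card {i. i < length u \<and> u ! i \<noteq> v ! i}"
  by (simp add: hamming_def pad_to_def)

lemma hamming_commute: "hamming u v = hamming v u"
  unfolding hamming_def by (simp add: max.commute eq_commute)

lemma hamming_Cons:
  assumes "length u = length v"
  shows "hamming (a # u) (b # v) = (if a = b then 0 else 1) + hamming u v"
proof -
  let ?D = "{i. i < length u \<and> u ! i \<noteq> v ! i}"
  have "{i. i < length (a # u) \<and> (a # u) ! i \<noteq> (b # v) ! i} =
      (if a = b then {} else {0}) \<union> Suc ` ?D"
    by (auto simp: less_Suc_eq_0_disj)
  moreover have "card (Suc ` ?D) = card ?D"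
    by (simp add: card_image)
  ultimately show ?thesis
    using assms by (simp add: hamming_eq_length card_insert_if)
qed

lemma hamming_same [simp]: "hamming u u = 0"
  by (simp add: hamming_eq_length)

lemma hamming_shift: "hamming (True # t) (True # False # t) = 2"
proof -
  have "hamming (True # t) (True # False # t) = hamming (False # True # t) (True # False # t)"
    by (simp add: hamming_def pad_to_def)
  then show ?thesis
    by (simp add: hamming_Cons)
qed

lemma successively_N_list: "successively (\<lambda>u v. hamming u v = 1) (N_list n)"
proof (induction n rule: N_list.induct)
  case (3 n)
  let ?H = "\<lambda>u v. hamming u v = 1"
  let ?pre = "(@) [True, False]"
  \<comment> \<open>All words of one list share their length and their leading 1, so replacing this
    1 by \<open>10\<close> preserves distances.\<close>
  have pre_tl: "hamming (?pre (tl u)) (?pre (tl v)) = hamming u v"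
    if u: "u \<in> set (N_list m)" and v: "v \<in> set (N_list m)" for u v m
  proof -
    obtain s t where "u = True # s" "v = True # t"
      using N_list_eq_Cons[OF u] N_list_eq_Cons[OF v] by blast
    moreover have "length u = length v"
      using u v by (simp add: set_N_list)
    ultimately show ?thesis
      by (simp add: hamming_Cons)
  qed
  \<comment> \<open>The list is reversed below, which swaps the arguments of the relation; symmetry
    of the distance absorbs this.\<close>
  have "successively (\<lambda>u v. ?H (?pre (tl v)) (?pre (tl u))) (N_list (Suc n))"
    by (rule successively_mono[OF "3.IH"(1)]) (metis pre_tl hamming_commute)
  then have A: "successively ?H (map ?pre (rev (map tl (N_list (Suc n)))))"
    by (simp add: successively_map)
  have "successively (\<lambda>u v. ?H (?pre v) (?pre u)) (N_list n)"
    by (rule successively_mono[OF "3.IH"(2)]) (auto simp: set_N_list hamming_Cons hamming_commute)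
  then have B: "successively ?H (map ?pre (rev (N_list n)))"
    by (simp add: successively_map)
  show ?case
  proof (cases "n = 0")
    case True
    then show ?thesis by (simp add: prefix_all_def)
  next
    case False
    then have ne: "N_list n \<noteq> []" "N_list (Suc n) \<noteq> []"
      using N_list_nonempty by simp_all
    obtain t where t: "last (N_list n) = True # t"
      using N_list_eq_Cons last_in_set ne by metis
    \<comment> \<open>These are the words at the junction: the first part ends with
      \<open>10\<close> followed by \<open>tl (hd (N_list (Suc n)))\<close>, which is
      \<open>0t\<close> by \<open>hd_N_list\<close>, and the second begins with \<open>10\<close>
      followed by \<open>last (N_list n)\<close>, which is \<open>1t\<close>.\<close>
    have "?H (?pre (False # t)) (?pre (True # t))"
      by (simp add: hamming_Cons)
    then have "?H (last (map ?pre (rev (map tl (N_list (Suc n))))))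
        (hd (map ?pre (rev (N_list n))))"
      using ne False t by (simp add: last_map last_rev hd_map hd_rev hd_N_list)
    then show ?thesis
      using A B by (simp add: successively_append_iff prefix_all_def)
  qed
qed auto

section \<open>Positions of the lists inside \<open>G_list\<close>\<close>

lemma flat_N_list_snth:
  assumes "a \<ge> 1"
  shows "flat (smap N_list (fromN a)) !! n =
    (if n < fib a then N_list a ! n else flat (smap N_list (fromN (Suc a))) !! (n - fib a))"
proof -
  have "\<forall>xs \<in> sset (smap N_list (fromN a)). xs \<noteq> []"
    using assms N_list_nonempty by (auto simp: stream.set_map)
  then show ?thesis
    by (simp add: flat_snth[of _ n])
qed

text \<open>The offset is \<open>fib a + ... + fib (a + d - 1)\<close>, the total length of the
  lists before \<open>N_list (a + d)\<close>. The start \<open>a\<close> varies because the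
  induction on \<open>d\<close> peels off the first list.\<close>

lemma flat_N_list_nth:
  assumes "a \<ge> 1" "i < fib (a + d)"
  shows "flat (smap N_list (fromN a)) !! (fib (a + d + 1) - fib (a + 1) + i) = N_list (a + d) ! i"
  using assms
proof (induction d arbitrary: a)
  case 0
  then show ?case
    by (simp add: flat_N_list_snth)
next
  case (Suc d)
  \<comment> \<open>Keeps the truncated subtraction exact, so that \<open>fib a\<close> can be split
    off the index.\<close>
  have "fib (Suc (Suc a)) \<le> fib (Suc a + d + 1)"
    by (rule fib_mono) simp
  moreover have "fib (Suc (Suc a)) = fib (Suc a) + fib a"
    by simp
  ultimately have *: "fib (a + Suc d + 1) - fib (a + 1) + i =
      fib a + (fib (Suc a + d + 1) - fib (Suc a + 1) + i)"
    by simp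
  have "flat (smap N_list (fromN a)) !! (fib (a + Suc d + 1) - fib (a + 1) + i) =
      flat (smap N_list (fromN (Suc a))) !! (fib (Suc a + d + 1) - fib (Suc a + 1) + i)"
    unfolding * using Suc.prems by (subst flat_N_list_snth) auto
  then show ?case
    using Suc.IH[of "Suc a"] Suc.prems by simp
qed

lemma g_word_fib:
  assumes "m \<ge> 1" "i < fib m"
  shows "g_word (fib (m + 1) + i) = N_list m ! i"
proof -
  \<comment> \<open>For \<open>a = 1\<close> the offset is \<open>fib (m + 1) - 1\<close>;
    positivity reconciles it with the index shift by one in \<open>g_word\<close>.\<close>
  have "fib (m + 1) \<ge> 1"
    by (simp add: Suc_leI fib_neq_0_nat)
  then show ?thesis
    using flat_N_list_nth[of 1 i "m - 1"] assms by (simp add: g_word_def G_list_def)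
qed

text \<open>Counting up by one either stays in the block of \<open>m\<close> or, from
  \<open>i = fib m - 1\<close>, reaches \<open>fib (m + 2)\<close>, the start of the next
  block.\<close>

lemma fib_decomposition:
  assumes "n \<ge> 1"
  obtains m i where "m \<ge> 1" "i < fib m" "n = fib (m + 1) + i"
proof -
  have "\<exists>m i. m \<ge> 1 \<and> i < fib m \<and> n = fib (m + 1) + i"
    using assms
  proof (induction n rule: nat_induct_at_least)
    case base
    show ?case by (intro exI[of _ 1] exI[of _ 0]) simp
  next
    case (Suc n)
    then obtain m i where mi: "m \<ge> 1" "i < fib m" "n = fib (m + 1) + i"
      by blast
    show ?case
    proof (cases "Suc i < fib m")
      case True
      then show ?thesis using mi by (intro exI[of _ m] exI[of _ "Suc i"]) simp
    next
      case False
      then show ?thesis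
        using mi by (intro exI[of _ "Suc m"] exI[of _ 0]) (auto simp: fib_neq_0_nat)
    qed
  qed
  then show thesis using that by blast
qed

lemma g_word_in_N_list:
  assumes "n \<ge> 1"
  obtains m where "m \<ge> 1" "g_word n \<in> set (N_list m)"
  using fib_decomposition[OF assms] g_word_fib by (metis length_N_list nth_mem)

section \<open>The bijection with classes of nonzero ZF-words\<close>

lemma inj_on_g_word: "inj_on g_word {1..}"
proof (rule inj_onI)
  fix n n' :: nat
  assume n: "n \<in> {1..}" "n' \<in> {1..}" and eq: "g_word n = g_word n'"
  obtain m i where mi: "m \<ge> 1" "i < fib m" "n = fib (m + 1) + i"
    using n fib_decomposition by auto
  obtain m' i' where mi': "m' \<ge> 1" "i' < fib m'" "n' = fib (m' + 1) + i'"
    using n fib_decomposition by auto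
  have w: "N_list m ! i = N_list m' ! i'"
    using eq mi mi' by (simp only: g_word_fib)
  \<comment> \<open>The length of the word determines the list; distinctness then determines the
    position.\<close>
  have "N_list m ! i \<in> set (N_list m)" "N_list m' ! i' \<in> set (N_list m')"
    using mi mi' by simp_all
  then have "m = m'"
    using w by (simp add: set_N_list)
  then show "n = n'"
    using w mi mi' distinct_N_list[of m] by (simp add: nth_eq_iff_index_eq)
qed

text \<open>Beginning with 1, the words of \<open>G_list\<close> are canonical representatives, so
  \<open>same_word\<close> between them is equality.\<close>

lemma dropWhile_g_word: "n \<ge> 1 \<Longrightarrow> dropWhile Not (g_word n) = g_word n"
  using g_word_in_N_list N_list_eq_Cons by (metis dropWhile.simps(2))

lemma same_g_word_iff:
  assumes "n \<ge> 1" "n' \<ge> 1"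
  shows "same_word (g_word n) (g_word n') \<longleftrightarrow> n = n'"
  using assms inj_on_g_word by (auto simp: same_word_iff dropWhile_g_word inj_on_def)

lemma zf_nonzero_g_word:
  assumes "n \<ge> 1"
  shows "zf_word (g_word n)" "nonzero_word (g_word n)"
proof -
  obtain m where m: "g_word n \<in> set (N_list m)"
    using g_word_in_N_list assms by blast
  then show "zf_word (g_word n)"
    by (simp add: set_N_list)
  show "nonzero_word (g_word n)"
    unfolding nonzero_word_def using N_list_eq_Cons[OF m] by (metis list.set_intros(1))
qed

text \<open>Without its leading zeros, \<open>w\<close> begins with 1 and so occurs in the list
  indexed by its remaining length.\<close>

lemma ex_g_word:
  assumes "zf_word w" "nonzero_word w"
  shows "\<exists>n\<ge>1. same_word (g_word n) w"
proof -
  let ?v = "dropWhile Not w"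
  have "?v \<noteq> []"
    using assms by (auto simp: nonzero_word_def dropWhile_eq_Nil_conv)
  then have "?v \<in> set (N_list (length ?v))" and m: "length ?v \<ge> 1"
    using assms hd_dropWhile[of Not w] by (auto simp: set_N_list zf_word_dropWhile Suc_le_eq)
  then obtain i where i: "i < fib (length ?v)" "N_list (length ?v) ! i = ?v"
    by (metis in_set_conv_nth length_N_list)
  let ?n = "fib (length ?v + 1) + i"
  have "?n \<ge> 1"
    by (simp add: Suc_leI fib_neq_0_nat)
  moreover have "g_word ?n = ?v"
    using g_word_fib m i by simp
  ultimately show ?thesis
    by (metis same_word_iff dropWhile_g_word)
qed

lemma bij_betw_word_class: "bij_betw (\<lambda>n. word_class (g_word n)) {1..} nonzero_zf_classes"
proof (rule bij_betw_imageI)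
  have class_eq: "word_class u = word_class v \<longleftrightarrow> same_word u v" for u v
    using eq_equiv_class_iff[OF equiv_same_word] by (simp add: word_class_def)
  then show "inj_on (\<lambda>n. word_class (g_word n)) {1..}"
    by (auto simp: inj_on_def same_g_word_iff)
  show "(\<lambda>n. word_class (g_word n)) ` {1..} = nonzero_zf_classes"
  proof (intro equalityI subsetI)
    fix C
    assume "C \<in> (\<lambda>n. word_class (g_word n)) ` {1..}"
    then show "C \<in> nonzero_zf_classes"
      unfolding nonzero_zf_classes_def word_class_def
      using zf_nonzero_g_word by (fastforce intro: quotientI)
  next
    fix C
    assume "C \<in> nonzero_zf_classes"
    then obtain w where "C = word_class w" "zf_word w" "nonzero_word w"
      unfolding nonzero_zf_classes_def word_class_def by (auto elim!: quotientE)
    then show "C \<in> (\<lambda>n. word_class (g_word n)) ` {1..}"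
      using ex_g_word class_eq by (metis atLeast_iff image_eqI)
  qed
qed

section \<open>Distances between consecutive words of \<open>G_list\<close>\<close>

lemma hamming_g_word:
  assumes "n \<ge> 1"
  shows "hamming (g_word n) (g_word (n + 1)) = (if \<exists>k\<ge>3. n + 1 = fib k then 2 else 1)"
proof -
  obtain m i where mi: "m \<ge> 1" "i < fib m" "n = fib (m + 1) + i"
    using assms fib_decomposition by blast
  have g: "g_word n = N_list m ! i"
    using mi g_word_fib by simp
  show ?thesis
  proof (cases "Suc i < fib m")
    case True
    then have "g_word (n + 1) = N_list m ! Suc i"
      using mi g_word_fib[of m "Suc i"] by simp
    then have "hamming (g_word n) (g_word (n + 1)) = 1"
      using successively_nth[OF successively_N_list, of i m] True g by simp
    moreover have "n + 1 \<noteq> fib k" for k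
    proof
      assume k: "n + 1 = fib k"
      \<comment> \<open>Inside a block, \<open>n + 1\<close> lies strictly between consecutive
        Fibonacci numbers, which monotonicity of \<open>fib\<close> excludes for
        \<open>fib k\<close>.\<close>
      have "fib (m + 1) < fib k" "fib k < fib (m + 2)"
        using mi True k[symmetric] by simp_all
      then have "m + 1 < k" "k < m + 2"
        using fib_mono by (meson not_le)+
      then show False by simp
    qed
    ultimately show ?thesis by simp
  next
    case False
    \<comment> \<open>At the end of a block the next word opens \<open>N_list (Suc m)\<close> and is
      one letter longer, so \<open>hamming_shift\<close> applies.\<close>
    then have i: "i = fib m - 1" and n: "n + 1 = fib (m + 2)"
      using mi by auto
    have ne: "N_list m \<noteq> []" "N_list (Suc m) \<noteq> []"
      using mi N_list_nonempty by simp_all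
    have "g_word n = last (N_list m)"
      using g i ne by (simp add: last_conv_nth)
    moreover have "g_word (n + 1) = hd (N_list (Suc m))"
      using g_word_fib[of "Suc m" 0] n ne by (simp add: hd_conv_nth fib_neq_0_nat)
    moreover obtain t where "last (N_list m) = True # t"
      using N_list_eq_Cons last_in_set ne by metis
    ultimately have "hamming (g_word n) (g_word (n + 1)) = 2"
      using mi hd_N_list hamming_shift by simp
    moreover have "\<exists>k\<ge>3. n + 1 = fib k"
      using mi n by (intro exI[of _ "m + 2"]) simp
    ultimately show ?thesis by simp
  qed
qed

theorem theorem2p7:
  shows "(\<forall>w. zf_word w \<and> nonzero_word w \<longrightarrow> (\<exists>!n. n \<ge> 1 \<and> same_word (g_word n) w))
    \<and> (\<forall>n\<ge>1. zf_word (g_word n) \<and> nonzero_word (g_word n))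
    \<and> (\<exists>\<phi>. (\<forall>n\<ge>1. \<phi> (word_class (g_word n)) = n) \<and> bij_betw \<phi> nonzero_zf_classes {1::nat..})
    \<and> (\<forall>n\<ge>1. hamming (g_word n) (g_word (n + 1)) = (if \<exists>k\<ge>3. n + 1 = fib k then 2 else 1))"
proof (intro conjI allI impI)
  fix w
  assume "zf_word w \<and> nonzero_word w"
  then obtain n where "n \<ge> 1" "same_word (g_word n) w"
    using ex_g_word by blast
  then show "\<exists>!n. n \<ge> 1 \<and> same_word (g_word n) w"
    using same_g_word_iff[of _ n] by (intro ex1I[of _ n]) (auto simp: same_word_iff)
next
  let ?f = "\<lambda>n. word_class (g_word n)"
  \<comment> \<open>Going from numbers to classes needs no choice of representative; the required
    map is the inverse.\<close>
  let ?\<phi> = "inv_into {1..} ?f"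
  have "\<forall>n\<ge>1. ?\<phi> (?f n) = n"
    using bij_betw_inv_into_left[OF bij_betw_word_class] by simp
  then show "\<exists>\<phi>. (\<forall>n\<ge>1. \<phi> (?f n) = n) \<and> bij_betw \<phi> nonzero_zf_classes {1::nat..}"
    using bij_betw_inv_into[OF bij_betw_word_class] by blast
qed (use zf_nonzero_g_word hamming_g_word in auto)

end
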